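(* Let $r\geq 1$, $p$ and $\ell$ be integers with $1\leq p<r$, and let $G$ be the complete $(\ell+1)$-partite graph having $\ell$ parts of size $r$ and one part of size $p$. Let $k\geq 2$ be an integer and $\ell_0=\left\lceil \max\left\{\sqrt{\tfrac{k}{2}+1},\ \tfrac{k-1}{r}+2\right\}\right\rceil$. If $\ell\geq \ell_0^2$, then $rc_k(G)=2$.
   Context: In an edge-colored graph (adjacent edges may receive the same color), a path is rainbow if no two of its edges have the same color. For a $\kappa$-connected graph $G$ and an integer $k$ with $1\leq k\leq\kappa$, the rainbow $k$-connectivity $rc_k(G)$ is the minimum integer $j$ such that there is an edge-coloring of $G$ with $j$ colors in which every two distinct vertices $u,v$ are connected by at least $k$ internally disjoint rainbow $u$–$v$ paths. *)

theory Defs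
  imports Complex_Main "HOL-Library.Disjoint_Sets" "HOL-Library.Extended_Nat"
begin

text \<open>
  A simple graph is given by its vertex set \<open>V\<close> and its edge set \<open>E\<close>, the edges being
  two-element subsets of \<open>V\<close>. A path is the list of its successive vertices.
\<close>

definition complete_multipartite :: "'a set \<Rightarrow> 'a set set \<Rightarrow> 'a set set \<Rightarrow> bool" where
  "complete_multipartite V E P \<longleftrightarrow>
     partition_on V P \<and>
     E = {{u, v} | u v. \<exists>A\<in>P. \<exists>B\<in>P. A \<noteq> B \<and> u \<in> A \<and> v \<in> B}"

definition path_between :: "'a set \<Rightarrow> 'a set set \<Rightarrow> 'a \<Rightarrow> 'a \<Rightarrow> 'a list \<Rightarrow> bool" where
  "path_between V E u v xs \<longleftrightarrow>
     xs \<noteq> [] \<and> hd xs = u \<and> last xs = v \<and> set xs \<subseteq> V \<and> distinct xs \<and>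
     successively (\<lambda>x y. {x, y} \<in> E) xs"

definition path_edges :: "'a list \<Rightarrow> 'a set set" where
  "path_edges xs = {{xs ! i, xs ! Suc i} | i. Suc i < length xs}"

definition inner_vertices :: "'a list \<Rightarrow> 'a set" where
  "inner_vertices xs = set (butlast (tl xs))"

definition rainbow :: "('a set \<Rightarrow> 'c) \<Rightarrow> 'a list \<Rightarrow> bool" where
  "rainbow c xs \<longleftrightarrow> inj_on c (path_edges xs)"

definition rainbow_k_connected ::
  "nat \<Rightarrow> 'a set \<Rightarrow> 'a set set \<Rightarrow> ('a set \<Rightarrow> 'c) \<Rightarrow> bool" where
  "rainbow_k_connected k V E c \<longleftrightarrow>
     (\<forall>u\<in>V. \<forall>v\<in>V. u \<noteq> v \<longrightarrow>
        (\<exists>Q. finite Q \<and> k \<le> card Q \<and>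
             (\<forall>xs\<in>Q. path_between V E u v xs \<and> rainbow c xs) \<and>
             pairwise (\<lambda>xs ys. disjnt (inner_vertices xs) (inner_vertices ys)) Q))"

text \<open>
  The value is \<open>\<infinity>\<close> if no coloring qualifies, which for a finite graph happens only when
  \<open>k\<close> exceeds its connectivity. Any finite value is an attained minimum. Requiring at most
  \<open>j\<close> colors instead of exactly \<open>j\<close> does not change the minimum.
\<close>

definition rc :: "nat \<Rightarrow> 'a set \<Rightarrow> 'a set set \<Rightarrow> enat" where
  "rc k V E =
     (INF j \<in> {j. \<exists>c :: 'a set \<Rightarrow> nat. c ` E \<subseteq> {..<j} \<and> rainbow_k_connected k V E c}. enat j)"

end

theory Submission
  imports Defs
begin

text \<open>
  With two colors only the paths of length at most two can be rainbow, so one has to color the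
  edges such that any two vertices have many common neighbors joined to them in different colors.
  Number the parts by \<open>0, \<dots>, l\<close> with \<open>A\<^sub>0\<close> last, number the vertices within each part, and write
  the part numbers row by row into a grid with \<open>m = l\<^sub>0\<close> columns. The edge between the vertices
  \<open>i\<close> of part \<open>x\<close> and \<open>j\<close> of part \<open>y\<close> is colored by the exclusive or of \<open>i = j\<close> and ``\<open>x\<close> and \<open>y\<close>
  lie in a common line (row or column) of the grid''.

  Two vertices of one part are separated by two vertices of every other full part, which makes at
  least \<open>2 * (l - 1) \<ge> k\<close>. For two different parts \<open>x\<close> and \<open>y\<close> there are at least \<open>m - 2\<close> full parts
  that are in line with exactly one of them, and at least \<open>m - 2\<close> that are in line with both or
  neither. If \<open>i = j\<close>, the former are full of separating vertices; otherwise each of the former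
  contains \<open>r - 2\<close> of them and each of the latter contains \<open>2\<close>. Either way there are at least
  \<open>r * (m - 2) \<ge> k - 1\<close>, and the edge itself is one more path.
\<close>

section \<open>Lines of the grid and the parts they distinguish\<close>

definition collinear :: "nat \<Rightarrow> nat \<Rightarrow> nat \<Rightarrow> bool" where
  "collinear m x y \<longleftrightarrow> x div m = y div m \<or> x mod m = y mod m"

lemma collinear_commute: "collinear m x y \<longleftrightarrow> collinear m y x"
  by (auto simp: collinear_def)

text \<open>Take column \<open>s\<close> within the first \<open>m\<close> rows, without the rows of
  \<open>x\<close> and \<open>y\<close>. No row is then shared with either number, so the column
  alone decides collinearity. As \<open>m\<^sup>2 \<le> l\<close>, all these cells are full parts,
  and at most two of them are dropped.\<close>

lemma grid_column:
  fixes m l s x y :: nat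
  assumes "s < m" and "m\<^sup>2 \<le> l"
  obtains C where "finite C" "m - 2 \<le> card C" "C \<subseteq> {..<l} - {x, y}"
    "\<And>d. d \<in> C \<Longrightarrow> collinear m x d \<longleftrightarrow> s = x mod m"
    "\<And>d. d \<in> C \<Longrightarrow> collinear m y d \<longleftrightarrow> s = y mod m"
proof
  let ?I = "{..<m} - {x div m, y div m}"
  let ?C = "(\<lambda>i. i * m + s) ` ?I"
  have "card {..<m} - card {x div m, y div m} \<le> card ?I"
    by (rule diff_card_le_card_Diff) simp
  moreover have "card {x div m, y div m} \<le> 2"
    by (simp add: card_insert_if)
  moreover have "inj_on (\<lambda>i. i * m + s) ?I"
    using assms by (auto simp: inj_on_def)
  ultimately show "m - 2 \<le> card ?C"
    by (simp add: card_image)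
  have less: "i * m + s < l" if "i < m" for i
  proof -
    have "i * m + s < Suc i * m" using assms by simp
    also have "\<dots> \<le> m * m" using that by (intro mult_right_mono) auto
    finally show ?thesis using assms by (simp add: power2_eq_square)
  qed
  have dm: "(i * m + s) div m = i" "(i * m + s) mod m = s" for i
    using assms by auto
  show "?C \<subseteq> {..<l} - {x, y}"
    using less dm(1) by fastforce
  show "collinear m x d \<longleftrightarrow> s = x mod m" if "d \<in> ?C" for d
    using that dm by (auto simp: collinear_def)
  show "collinear m y d \<longleftrightarrow> s = y mod m" if "d \<in> ?C" for d
    using that dm by (auto simp: collinear_def)
qed simp

text \<open>Distinct numbers in one column lie in different rows, the smaller one in the earlier
  row. That row ends before \<open>y\<close>, so it is complete and avoids \<open>l\<close>; its
  cells outside the common column are in line with \<open>x\<close> only.\<close>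

lemma grid_row:
  fixes m l x y :: nat
  assumes "m > 0" "x mod m = y mod m" "x < y" "y \<le> l"
  obtains D where "finite D" "m - 1 \<le> card D" "D \<subseteq> {..<l} - {x, y}"
    "\<And>d. d \<in> D \<Longrightarrow> collinear m x d \<and> \<not> collinear m y d"
proof
  let ?I = "{..<m} - {x mod m}"
  let ?D = "(\<lambda>s. x div m * m + s) ` ?I"
  show "m - 1 \<le> card ?D"
    using assms by (subst card_image) (auto simp: card_Diff_singleton_if)
  have "x div m \<noteq> y div m"
    using assms by (metis div_mult_mod_eq less_irrefl)
  moreover have "x div m \<le> y div m"
    using assms by (simp add: div_le_mono)
  ultimately have row: "x div m < y div m"
    by simp
  have less: "x div m * m + s < y" if "s < m" for s
  proof -
    have "x div m * m + s < Suc (x div m) * m" using that by simp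
    also have "\<dots> \<le> y div m * m" using row by (intro mult_right_mono) auto
    also have "\<dots> \<le> y" by simp
    finally show ?thesis .
  qed
  have dm: "(x div m * m + s) div m = x div m" "(x div m * m + s) mod m = s" if "s < m" for s
    using that by auto
  show "?D \<subseteq> {..<l} - {x, y}"
    using less dm(2) assms by fastforce
  show "collinear m x d \<and> \<not> collinear m y d" if "d \<in> ?D" for d
    using that dm row assms(2) by (auto simp: collinear_def)
qed simp

lemma grid_separation:
  fixes m l x y :: nat
  assumes "m \<ge> 3" "m\<^sup>2 \<le> l" "x \<noteq> y" "x \<le> l" "y \<le> l"
  obtains D where "finite D" "m - 2 \<le> card D" "D \<subseteq> {..<l} - {x, y}"
    "\<And>d. d \<in> D \<Longrightarrow> collinear m x d \<noteq> collinear m y d"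
proof (cases "x mod m = y mod m")
  case True
  \<comment> \<open>The row of the smaller number is used: the row of the larger one may be
    incomplete or contain \<open>l\<close>.\<close>
  consider "x < y" | "y < x" using assms by linarith
  then show ?thesis
  proof cases
    case 1
    obtain D where "finite D" "m - 1 \<le> card D" "D \<subseteq> {..<l} - {x, y}"
        "\<And>d. d \<in> D \<Longrightarrow> collinear m x d \<and> \<not> collinear m y d"
      using grid_row[of m x y l] 1 True assms by auto
    with that[of D] show ?thesis by simp
  next
    case 2
    obtain D where "finite D" "m - 1 \<le> card D" "D \<subseteq> {..<l} - {y, x}"
        "\<And>d. d \<in> D \<Longrightarrow> collinear m y d \<and> \<not> collinear m x d"
      using grid_row[of m y x l] 2 True assms by auto
    with that[of D] show ?thesis by (simp add: insert_commute)
  qed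
next
  case False
  \<comment> \<open>The column of \<open>x\<close>, away from both rows, is in line with
    \<open>x\<close> but not with \<open>y\<close>.\<close>
  have "x mod m < m" using assms by simp
  from grid_column[OF this assms(2), of x y] obtain C where "finite C" "m - 2 \<le> card C"
    "C \<subseteq> {..<l} - {x, y}" "\<And>d. d \<in> C \<Longrightarrow> collinear m x d \<longleftrightarrow> x mod m = x mod m"
    "\<And>d. d \<in> C \<Longrightarrow> collinear m y d \<longleftrightarrow> x mod m = y mod m"
    by blast
  with that[of C] False show ?thesis by simp
qed

lemma grid_agreement:
  fixes m l x y :: nat
  assumes "m \<ge> 3" "m\<^sup>2 \<le> l"
  obtains D where "finite D" "m - 2 \<le> card D" "D \<subseteq> {..<l} - {x, y}"
    "\<And>d. d \<in> D \<Longrightarrow> collinear m x d = collinear m y d"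
proof -
  \<comment> \<open>If \<open>x\<close> and \<open>y\<close> share a column, any \<open>s\<close>
    works. Otherwise \<open>s\<close> is a third column, in line with neither; this is where
    \<open>m \<ge> 3\<close> enters.\<close>
  have "\<exists>s<m. (s = x mod m) = (s = y mod m)"
  proof (rule ccontr)
    assume "\<not> ?thesis"
    then have "{..<m} \<subseteq> {x mod m, y mod m}" by auto
    then have "card {..<m} \<le> card {x mod m, y mod m}" by (intro card_mono) auto
    also have "\<dots> \<le> 2" by (simp add: card_insert_if)
    finally show False using assms by simp
  qed
  then obtain s where s: "s < m" "(s = x mod m) = (s = y mod m)" by blast
  from grid_column[OF s(1) assms(2), of x y] obtain C where "finite C" "m - 2 \<le> card C"
    "C \<subseteq> {..<l} - {x, y}" "\<And>d. d \<in> C \<Longrightarrow> collinear m x d \<longleftrightarrow> s = x mod m"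
    "\<And>d. d \<in> C \<Longrightarrow> collinear m y d \<longleftrightarrow> s = y mod m"
    by blast
  with that[of C] s show ?thesis by simp
qed

section \<open>The coloring in coordinates and its separating vertices\<close>

definition grid_color :: "nat \<Rightarrow> nat \<times> nat \<Rightarrow> nat \<times> nat \<Rightarrow> bool" where
  "grid_color m a b \<longleftrightarrow> (snd a = snd b) \<noteq> collinear m (fst a) (fst b)"

lemma grid_color_commute: "grid_color m a b = grid_color m b a"
  by (auto simp: grid_color_def collinear_commute)

text \<open>Candidates come from the parts below \<open>l\<close>, where every index below
  \<open>r\<close> belongs to a vertex; in part \<open>l\<close> some indices are missing. The
  conditions on \<open>fst\<close> make \<open>w\<close> a common neighbor.\<close>

definition separators :: "nat \<Rightarrow> nat \<Rightarrow> nat \<Rightarrow> nat \<times> nat \<Rightarrow> nat \<times> nat \<Rightarrow> (nat \<times> nat) set" where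
  "separators m l r a b =
     {w \<in> {..<l} \<times> {..<r}. fst w \<noteq> fst a \<and> fst w \<noteq> fst b \<and> grid_color m a w \<noteq> grid_color m b w}"

lemma finite_separators: "finite (separators m l r a b)"
  by (rule finite_subset[of _ "{..<l} \<times> {..<r}"]) (auto simp: separators_def)

text \<open>Collinearity with \<open>w\<close> is the same for both ends, so only the indices
  matter: the colors differ when \<open>w\<close> has index \<open>i\<close> or
  \<open>j\<close>.\<close>

lemma card_separators_same_part:
  assumes "i < r" "j < r" "i \<noteq> j"
  shows "2 * (l - 1) \<le> card (separators m l r (x, i) (x, j))"
proof -
  have "card (({..<l} - {x}) \<times> {i, j}) = card ({..<l} - {x}) * 2"
    using assms by (simp add: card_cartesian_product)
  moreover have "l - 1 \<le> card ({..<l} - {x})"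
    by (simp add: card_Diff_singleton_if)
  moreover have "({..<l} - {x}) \<times> {i, j} \<subseteq> separators m l r (x, i) (x, j)"
    using assms by (auto simp: separators_def grid_color_def)
  then have "card (({..<l} - {x}) \<times> {i, j}) \<le> card (separators m l r (x, i) (x, j))"
    by (intro card_mono finite_separators)
  ultimately show ?thesis by linarith
qed

text \<open>The colors at \<open>w\<close> differ iff exactly one of collinearity and index equality
  distinguishes the two ends. Parts that separate \<open>x\<close> from \<open>y\<close> thus
  contribute the indices equal to both or neither of \<open>i\<close> and \<open>j\<close>, the
  other parts those equal to exactly one.\<close>

lemma card_separators_different_parts:
  assumes "m \<ge> 3" "m\<^sup>2 \<le> l" "x \<noteq> y" "x \<le> l" "y \<le> l" "i < r" "j < r"
  shows "r * (m - 2) \<le> card (separators m l r (x, i) (y, j))"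
proof -
  obtain D where D: "finite D" "m - 2 \<le> card D" "D \<subseteq> {..<l} - {x, y}"
    "\<And>d. d \<in> D \<Longrightarrow> collinear m x d \<noteq> collinear m y d"
    using grid_separation[OF assms(1-5)] by blast
  show ?thesis
  proof (cases "i = j")
    case True
    have "D \<times> {..<r} \<subseteq> separators m l r (x, i) (y, j)"
      using D True by (auto simp: separators_def grid_color_def)
    then have "card (D \<times> {..<r}) \<le> card (separators m l r (x, i) (y, j))"
      by (intro card_mono finite_separators)
    moreover have "(m - 2) * r \<le> card D * r"
      using D by simp
    moreover have "card (D \<times> {..<r}) = card D * r"
      by (simp add: card_cartesian_product)
    ultimately have "(m - 2) * r \<le> card (separators m l r (x, i) (y, j))"
      by linarith
    then show ?thesis by (simp only: mult.commute)
  next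
    case False
    obtain D' where D': "finite D'" "m - 2 \<le> card D'" "D' \<subseteq> {..<l} - {x, y}"
      "\<And>d. d \<in> D' \<Longrightarrow> collinear m x d = collinear m y d"
      using grid_agreement[OF assms(1-2), of x y] by blast
    let ?S = "D \<times> ({..<r} - {i, j})" and ?S' = "D' \<times> {i, j}"
    have "card {i, j} = 2" "card ({..<r} - {i, j}) = r - 2"
      using assms False by (simp_all add: card_Diff_subset numeral_2_eq_2)
    then have card: "card ?S = card D * (r - 2)" "card ?S' = card D' * 2"
      by (simp_all only: card_cartesian_product)
    have "?S \<inter> ?S' = {}" by auto
    then have "card (?S \<union> ?S') = card ?S + card ?S'"
      using D(1) D'(1) by (intro card_Un_disjoint) auto
    also have "\<dots> = card D * (r - 2) + card D' * 2"
      by (simp only: card)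
    also have "\<dots> \<ge> (m - 2) * (r - 2) + (m - 2) * 2"
      using D(2) D'(2) by (intro add_mono mult_right_mono) auto
    also have "(m - 2) * (r - 2) + (m - 2) * 2 = r * (m - 2)"
    proof -
      \<comment> \<open>Distinct \<open>i\<close> and \<open>j\<close> below \<open>r\<close> force
        \<open>r \<ge> 2\<close>, so the truncated subtraction is exact.\<close>
      have "r - 2 + 2 = r" using assms False by linarith
      then show ?thesis by (metis distrib_left mult.commute)
    qed
    finally have "r * (m - 2) \<le> card (?S \<union> ?S')" .
    moreover have "?S \<union> ?S' \<subseteq> separators m l r (x, i) (y, j)"
    proof -
      have "?S \<subseteq> separators m l r (x, i) (y, j)"
        using D by (auto simp: separators_def grid_color_def)
      moreover have "?S' \<subseteq> separators m l r (x, i) (y, j)"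
        using D' False assms by (auto simp: separators_def grid_color_def)
      ultimately show ?thesis by simp
    qed
    then have "card (?S \<union> ?S') \<le> card (separators m l r (x, i) (y, j))"
      by (intro card_mono finite_separators)
    ultimately show ?thesis by simp
  qed
qed

section \<open>Coordinates for the multipartite graph\<close>

text \<open>\<open>A\<^sub>0\<close> receives the last number \<open>l\<close>, so the smaller
  numbers belong to parts of size exactly \<open>r\<close>, and every pair in
  \<open>{..<l} \<times> {..<r}\<close> is realized by a vertex.\<close>

lemma multipartite_coordinates:
  assumes "complete_multipartite V E P" "card P = l + 1" "A\<^sub>0 \<in> P" "1 \<le> card A\<^sub>0" "card A\<^sub>0 \<le> r"
    and r: "\<And>A. A \<in> P \<Longrightarrow> A \<noteq> A\<^sub>0 \<Longrightarrow> card A = r" "1 \<le> r"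
  obtains f :: "'a \<Rightarrow> nat \<times> nat" where
    "f ` V \<subseteq> {..l} \<times> {..<r}" "inj_on f V" "{..<l} \<times> {..<r} \<subseteq> f ` V"
    "\<And>u v. u \<in> V \<Longrightarrow> v \<in> V \<Longrightarrow> {u, v} \<in> E \<longleftrightarrow> fst (f u) \<noteq> fst (f v)"
proof -
  have part: "partition_on V P"
    and E: "E = {{u, v} | u v. \<exists>A\<in>P. \<exists>B\<in>P. A \<noteq> B \<and> u \<in> A \<and> v \<in> B}"
    using assms(1) by (simp_all add: complete_multipartite_def)
  have uniq: "A = B" if "A \<in> P" "B \<in> P" "v \<in> A" "v \<in> B" for A B v
    using partition_onD2[OF part] that unfolding disjoint_def by blast
  have "finite P" using assms(2) by (intro card_ge_0_finite) simp
  then have "finite (P - {A\<^sub>0})" "card (P - {A\<^sub>0}) = card {..<l}"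
    using assms(2,3) by simp_all
  then obtain e where e: "bij_betw e (P - {A\<^sub>0}) {..<l}"
    using finite_same_card_bij[of "P - {A\<^sub>0}" "{..<l}"] by auto
  have cardP: "card A \<le> r" "finite A" if "A \<in> P" for A
  proof -
    show "card A \<le> r" using r(1)[OF that] assms(5) by (cases "A = A\<^sub>0") simp_all
    \<comment> \<open>Infinite sets have \<open>card\<close> zero, so positive cardinality yields
      finiteness.\<close>
    have "card A > 0" using r(1)[OF that] r(2) assms(4) by (cases "A = A\<^sub>0") simp_all
    then show "finite A" by (rule card_ge_0_finite)
  qed
  have "\<forall>A\<in>P. \<exists>h. bij_betw h A {0..<card A}"
    by (intro ballI ex_bij_betw_finite_nat cardP(2))
  from bchoice[OF this] obtain h where h: "\<And>A. A \<in> P \<Longrightarrow> bij_betw (h A) A {0..<card A}"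
    by blast
  \<comment> \<open>\<open>q v\<close> will be the part of \<open>v\<close>, unique by
    disjointness.\<close>
  have "\<forall>v\<in>V. \<exists>A. A \<in> P \<and> v \<in> A"
    using partition_onD1[OF part] by blast
  from bchoice[OF this] obtain q where q: "\<And>v. v \<in> V \<Longrightarrow> q v \<in> P" "\<And>v. v \<in> V \<Longrightarrow> v \<in> q v"
    by blast
  have q_eq: "v \<in> V" "q v = A" if "A \<in> P" "v \<in> A" for v A
  proof -
    show v: "v \<in> V" using that partition_onD1[OF part] by blast
    show "q v = A" by (rule uniq[OF q(1)[OF v] that(1) q(2)[OF v] that(2)])
  qed
  define g where "g A = (if A = A\<^sub>0 then l else e A)" for A
  have g_less: "g A < l" if "A \<in> P" "A \<noteq> A\<^sub>0" for A
    using bij_betwE[OF e] that by (simp add: g_def)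
  have g_le: "g A \<le> l" if "A \<in> P" for A
    using g_less[OF that] by (cases "A = A\<^sub>0") (simp add: g_def, simp)
  have g_inj: "A = B" if "A \<in> P" "B \<in> P" "g A = g B" for A B
  proof (cases "A = A\<^sub>0 \<or> B = A\<^sub>0")
    case True
    have "g A\<^sub>0 = l" by (simp add: g_def)
    with that(3) True have "g A = l" "g B = l" by metis+
    then have "A = A\<^sub>0" "B = A\<^sub>0" using g_less[OF that(1)] g_less[OF that(2)] by force+
    then show ?thesis by simp
  next
    case False
    then have "e A = e B" "A \<in> P - {A\<^sub>0}" "B \<in> P - {A\<^sub>0}" using that by (simp_all add: g_def)
    then show ?thesis by (rule inj_onD[OF bij_betw_imp_inj_on[OF e]])
  qed
  define f where "f v = (g (q v), h (q v) v)" for v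
  show ?thesis
  proof
    show "f ` V \<subseteq> {..l} \<times> {..<r}"
    proof
      fix z assume "z \<in> f ` V"
      then obtain v where v: "v \<in> V" "z = f v" by blast
      have "g (q v) \<le> l" by (rule g_le[OF q(1)[OF v(1)]])
      moreover have "h (q v) v < card (q v)"
        using bij_betwE[OF h[OF q(1)[OF v(1)]]] q(2)[OF v(1)] by simp
      then have "h (q v) v < r" using cardP(1)[OF q(1)[OF v(1)]] by simp
      ultimately show "z \<in> {..l} \<times> {..<r}" using v by (simp add: f_def)
    qed
    show "inj_on f V"
    proof (rule inj_onI)
      fix u v assume uv: "u \<in> V" "v \<in> V" "f u = f v"
      then have "g (q u) = g (q v)" by (simp add: f_def)
      then have eq: "q u = q v" by (rule g_inj[OF q(1)[OF uv(1)] q(1)[OF uv(2)]])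
      then have "h (q u) u = h (q u) v" using uv(3) by (simp add: f_def)
      moreover have "u \<in> q u" "v \<in> q u" using q(2)[OF uv(1)] q(2)[OF uv(2)] eq by simp_all
      ultimately show "u = v"
        by (rule inj_onD[OF bij_betw_imp_inj_on[OF h[OF q(1)[OF uv(1)]]]])
    qed
    show "{..<l} \<times> {..<r} \<subseteq> f ` V"
    proof clarsimp
      fix d t assume dt: "d < l" "t < r"
      then have "d \<in> e ` (P - {A\<^sub>0})"
        using bij_betw_imp_surj_on[OF e] by simp
      then obtain A where A: "A \<in> P" "A \<noteq> A\<^sub>0" "e A = d" by blast
      then have "t \<in> h A ` A"
        using bij_betw_imp_surj_on[OF h[OF A(1)]] r(1)[OF A(1,2)] dt by simp
      then obtain v where "v \<in> A" "t = h A v" by blast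
      then have "v \<in> V" "f v = (d, t)" using q_eq[OF A(1)] A by (simp_all add: f_def g_def)
      then show "(d, t) \<in> f ` V" by force
    qed
    show "{u, v} \<in> E \<longleftrightarrow> fst (f u) \<noteq> fst (f v)" if uv: "u \<in> V" "v \<in> V" for u v
    proof
      assume "{u, v} \<in> E"
      then obtain a b A B where AB: "{u, v} = {a, b}" "A \<in> P" "B \<in> P" "A \<noteq> B" "a \<in> A" "b \<in> B"
        unfolding E by blast
      then have "q a \<noteq> q b" "q a \<in> P" "q b \<in> P"
        using q_eq(2)[of A a] q_eq(2)[of B b] by simp_all
      then have "g (q a) \<noteq> g (q b)" using g_inj by blast
      then show "fst (f u) \<noteq> fst (f v)" using AB(1) by (auto simp: f_def doubleton_eq_iff)
    next
      assume "fst (f u) \<noteq> fst (f v)"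
      then have "q u \<noteq> q v" by (auto simp: f_def)
      then show "{u, v} \<in> E" unfolding E using q uv by blast
    qed
  qed
qed

section \<open>Rainbow paths with one color and with two\<close>

lemma path_edges_Cons2: "path_edges (x # y # zs) = insert {x, y} (path_edges (y # zs))"
proof -
  have *: "{i. Suc i < length (x # y # zs)} = insert 0 (Suc ` {i. Suc i < length (y # zs)})"
    by (auto simp: image_iff gr0_conv_Suc less_Suc_eq_0_disj)
  have edges: "path_edges xs = (\<lambda>i. {xs ! i, xs ! Suc i}) ` {i. Suc i < length xs}" for xs :: "'b list"
    by (auto simp: path_edges_def)
  show ?thesis unfolding edges * by (simp add: image_image)
qed

lemma path_edges_singleton: "path_edges [x] = {}"
  by (simp add: path_edges_def)

text \<open>A longer path begins with two different edges, because its vertices are distinct; having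
  the same color, they cannot both lie on a rainbow path.\<close>

lemma monochromatic_rainbow_path:
  assumes "path_between V E u v xs" "rainbow c xs" "u \<noteq> v"
    and mono: "\<And>e e'. e \<in> E \<Longrightarrow> e' \<in> E \<Longrightarrow> c e = c e'"
  shows "xs = [u, v]"
\<comment> \<open>This rule splits lists by length 0, 1 and at least 2; the first two cannot join
  \<open>u\<close> to a different \<open>v\<close>.\<close>
proof (cases xs rule: remdups_adj.cases)
  case (3 x y zs)
  show ?thesis
  proof (cases zs)
    case Nil
    then show ?thesis using assms 3 by (simp add: path_between_def)
  next
    case (Cons z zs')
    have "{x, y} \<in> E" "{y, z} \<in> E" "x \<noteq> z" "x \<noteq> y"
      using assms(1) 3 Cons by (auto simp: path_between_def)
    moreover from this(1,2) have "c {x, y} = c {y, z}" by (rule mono)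
    then have "{x, y} = {y, z}"
      using assms(2) 3 Cons by (auto simp: rainbow_def path_edges_Cons2 dest: inj_onD)
    ultimately show ?thesis by (auto simp: doubleton_eq_iff)
  qed
qed (use assms in \<open>auto simp: path_between_def\<close>)

text \<open>With fewer than two colors all edges are colored alike, so \<open>[u, v]\<close> is the
  only possible rainbow path, too few for \<open>k \<ge> 2\<close>.\<close>

lemma two_le_rc:
  assumes "2 \<le> k" "u \<in> V" "v \<in> V" "u \<noteq> v"
  shows "2 \<le> rc k V E"
  unfolding rc_def
proof (rule INF_greatest)
  fix j assume "j \<in> {j. \<exists>c :: 'a set \<Rightarrow> nat. c ` E \<subseteq> {..<j} \<and> rainbow_k_connected k V E c}"
  then obtain c :: "'a set \<Rightarrow> nat" where c: "c ` E \<subseteq> {..<j}" "rainbow_k_connected k V E c"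
    by blast
  obtain Q where Q: "finite Q" "k \<le> card Q" "\<forall>xs\<in>Q. path_between V E u v xs \<and> rainbow c xs"
    using c(2) assms unfolding rainbow_k_connected_def by blast
  have "2 \<le> j"
  proof (rule ccontr)
    assume "\<not> 2 \<le> j"
    then have "c e = c e'" if "e \<in> E" "e' \<in> E" for e e'
    proof -
      have "c e < j" "c e' < j" using c(1) that by auto
      with \<open>\<not> 2 \<le> j\<close> show ?thesis by linarith
    qed
    then have "Q \<subseteq> {[u, v]}"
      using monochromatic_rainbow_path[of V E u v _ c] Q(3) assms(4) by blast
    then have "card Q \<le> 1" using card_mono[of "{[u, v]}" Q] by simp
    with Q(2) assms(1) show False by simp
  qed
  then show "2 \<le> enat j" by (metis enat_ord_simps(1) numeral_eq_enat)
qed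

text \<open>Each path \<open>[u, w, v]\<close> has \<open>w\<close> as its only inner vertex, so
  different \<open>w\<close> give disjoint interiors. An edge between \<open>u\<close> and
  \<open>v\<close> has no inner vertex and adds one more path.\<close>

lemma rainbow_paths_through:
  assumes "u \<in> V" "v \<in> V" "u \<noteq> v" "W \<subseteq> V" "finite W"
    and W: "\<And>w. w \<in> W \<Longrightarrow> {u, w} \<in> E \<and> {w, v} \<in> E \<and> w \<noteq> u \<and> w \<noteq> v \<and> c {u, w} \<noteq> c {w, v}"
    and k: "k \<le> card W + (if {u, v} \<in> E then 1 else 0)"
  shows "\<exists>Q. finite Q \<and> k \<le> card Q \<and> (\<forall>xs\<in>Q. path_between V E u v xs \<and> rainbow c xs) \<and>
           pairwise (\<lambda>xs ys. disjnt (inner_vertices xs) (inner_vertices ys)) Q"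
proof (intro exI conjI)
  let ?D = "if {u, v} \<in> E then {[u, v]} else {}"
  let ?T = "(\<lambda>w. [u, w, v]) ` W"
  let ?Q = "?D \<union> ?T"
  show "finite ?Q" using assms(5) by simp
  have "card ?Q = card ?D + card ?T"
    using assms(5) by (intro card_Un_disjoint) auto
  moreover have "card ?T = card W"
    by (intro card_image) (auto simp: inj_on_def)
  ultimately show "k \<le> card ?Q" using k by (auto split: if_splits)
  have "path_between V E u v [u, w, v] \<and> rainbow c [u, w, v]" if "w \<in> W" for w
    using that W[OF that] assms(1-4)
    by (auto simp: path_between_def rainbow_def path_edges_Cons2 path_edges_singleton)
  moreover have "path_between V E u v [u, v] \<and> rainbow c [u, v]" if "{u, v} \<in> E"
    using that assms(1-3)
    by (auto simp: path_between_def rainbow_def path_edges_Cons2 path_edges_singleton)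
  ultimately show "\<forall>xs\<in>?Q. path_between V E u v xs \<and> rainbow c xs"
    by (auto split: if_splits)
  show "pairwise (\<lambda>xs ys. disjnt (inner_vertices xs) (inner_vertices ys)) ?Q"
    by (auto simp: pairwise_def inner_vertices_def)
qed

section \<open>Transfer of the coloring to the graph and the value of \<open>rc\<close>\<close>

lemma grid_coloring_rainbow_k_connected:
  fixes f :: "'a \<Rightarrow> nat \<times> nat" and k l m r :: nat
  assumes f: "f ` V \<subseteq> {..l} \<times> {..<r}" "inj_on f V" "{..<l} \<times> {..<r} \<subseteq> f ` V"
    and E: "\<And>u v. u \<in> V \<Longrightarrow> v \<in> V \<Longrightarrow> {u, v} \<in> E \<longleftrightarrow> fst (f u) \<noteq> fst (f v)"
    and c: "\<And>u v. u \<noteq> v \<Longrightarrow> c {u, v} = (if grid_color m (f u) (f v) then 1 else 0 :: nat)"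
    and m: "m \<ge> 3" "m\<^sup>2 \<le> l" "k \<le> 2 * (l - 1)" "k \<le> r * (m - 2) + 1"
  shows "rainbow_k_connected k V E c"
  unfolding rainbow_k_connected_def
proof (intro ballI impI)
  fix u v assume uv: "u \<in> V" "v \<in> V" "u \<noteq> v"
  obtain x i y j where xy: "f u = (x, i)" "f v = (y, j)" by (metis surj_pair)
  have bounds: "x \<le> l" "i < r" "y \<le> l" "j < r" using f(1) uv xy by force+
  have ne: "(x, i) \<noteq> (y, j)" using f(2) uv xy by (metis inj_onD)
  let ?S = "separators m l r (x, i) (y, j)"
  have sub: "?S \<subseteq> f ` V" using f(3) by (auto simp: separators_def)
  \<comment> \<open>\<open>W\<close> pulls the separating pairs back to vertices. All of them lie in
    the image of \<open>f\<close>, which is injective on \<open>V\<close>, so the count is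
    preserved.\<close>
  define W where "W = {w \<in> V. f w \<in> ?S}"
  have img: "f ` W = ?S" using sub unfolding W_def by blast
  have inj: "inj_on f W" using f(2) by (rule inj_on_subset) (auto simp: W_def)
  have "finite W" using finite_separators img inj by (metis finite_image_iff)
  moreover have "card W = card ?S" using img inj by (metis card_image)
  moreover have "k \<le> card ?S + (if {u, v} \<in> E then 1 else 0)"
  \<comment> \<open>Ends in one part are nonadjacent and rely on the bound
    \<open>2 * (l - 1)\<close>; for ends in different parts the edge supplies the \<open>+ 1\<close>
    of the other bound.\<close>
  proof (cases "x = y")
    case True
    then have "2 * (l - 1) \<le> card ?S"
      using card_separators_same_part[of i r j l m x] bounds ne by simp
    with m show ?thesis by simp
  next
    case False
    then have "r * (m - 2) \<le> card ?S"
      using card_separators_different_parts[of m l x y i r j] bounds m by simp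
    moreover have "{u, v} \<in> E" using E uv xy False by simp
    ultimately show ?thesis using m by simp
  qed
  moreover have "{u, w} \<in> E \<and> {w, v} \<in> E \<and> w \<noteq> u \<and> w \<noteq> v \<and> c {u, w} \<noteq> c {w, v}"
    if "w \<in> W" for w
  proof -
    have w: "w \<in> V" "fst (f w) \<noteq> x" "fst (f w) \<noteq> y"
        "grid_color m (f u) (f w) \<noteq> grid_color m (f v) (f w)"
      using that xy by (auto simp: W_def separators_def)
    then have "w \<noteq> u" "w \<noteq> v" using xy by auto
    moreover have "{u, w} \<in> E" "{w, v} \<in> E" using E uv w xy by auto
    moreover have "c {u, w} \<noteq> c {w, v}"
      using c[of u w] c[of w v] w(4) calculation(1,2) grid_color_commute[of m "f v" "f w"] by auto
    ultimately show ?thesis by simp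
  qed
  ultimately show "\<exists>Q. finite Q \<and> k \<le> card Q \<and>
      (\<forall>xs\<in>Q. path_between V E u v xs \<and> rainbow c xs) \<and>
      pairwise (\<lambda>xs ys. disjnt (inner_vertices xs) (inner_vertices ys)) Q"
    using uv by (intro rainbow_paths_through[where W = W]) (auto simp: W_def)
qed

theorem theorem4:
  fixes V :: "'a set" and E P :: "'a set set" and A\<^sub>0 :: "'a set"
    and r p l k :: nat and l\<^sub>0 :: int
  assumes "r \<ge> 1" and "1 \<le> p" and "p < r"
    and "complete_multipartite V E P"
    and "card P = l + 1"
    and "A\<^sub>0 \<in> P" and "card A\<^sub>0 = p"
    and "\<And>A. A \<in> P \<Longrightarrow> A \<noteq> A\<^sub>0 \<Longrightarrow> card A = r"
    and "k \<ge> 2"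
    and "l\<^sub>0 = \<lceil>max (sqrt (real k / 2 + 1)) ((real k - 1) / real r + 2)\<rceil>"
    and "int l \<ge> l\<^sub>0\<^sup>2"
  shows "rc k V E = 2"
proof (rule antisym)
  define m where "m = nat l\<^sub>0"
  have ceil: "sqrt (real k / 2 + 1) \<le> real_of_int l\<^sub>0" "(real k - 1) / real r + 2 \<le> real_of_int l\<^sub>0"
    using assms(10) by linarith+
  \<comment> \<open>Since \<open>k \<ge> 2\<close>, the second term of the maximum exceeds 2, so its
    ceiling is at least 3.\<close>
  moreover have "(real k - 1) / real r > 0" using assms by simp
  ultimately have "l\<^sub>0 \<ge> 3" by linarith
  then have m: "m \<ge> 3" "int m = l\<^sub>0" by (auto simp: m_def)
  have ml: "m\<^sup>2 \<le> l" using assms(11) m(2) by (metis of_nat_le_iff of_nat_power)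
  have "sqrt (real k / 2 + 1) \<le> real m" "(real k - 1) / real r + 2 \<le> real m"
    using ceil m(2) by (metis of_int_of_nat_eq)+
  \<comment> \<open>The square root bound, squared and combined with
    \<open>m\<^sup>2 \<le> l\<close>, serves pairs in one part; the other bound, multiplied by
    \<open>r\<close>, serves pairs in different parts.\<close>
  then have km2: "real k / 2 + 1 \<le> (real m)\<^sup>2" and km: "real k - 1 \<le> real r * (real m - 2)"
    using assms(1) by (auto dest: sqrt_le_D simp: field_simps simp del: real_sqrt_divide)
  have l: "l \<ge> 1"
    using ml m(1) by (metis One_nat_def le_trans one_le_numeral one_le_power)
  have "(real m)\<^sup>2 \<le> real l"
    using ml by (metis of_nat_le_iff of_nat_power)
  with km2 have "real k / 2 + 1 \<le> real l" by (rule order_trans)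
  then have "real k \<le> 2 * (real l - 1)" by simp
  then have "real k \<le> real (2 * (l - 1))" "real k \<le> real (r * (m - 2) + 1)"
    using km m(1) l by (simp_all add: of_nat_diff)
  then have k: "k \<le> 2 * (l - 1)" "k \<le> r * (m - 2) + 1"
    by (simp_all only: of_nat_le_iff)
  obtain f :: "'a \<Rightarrow> nat \<times> nat" where
    f: "f ` V \<subseteq> {..l} \<times> {..<r}" "inj_on f V" "{..<l} \<times> {..<r} \<subseteq> f ` V"
      "\<And>u v. u \<in> V \<Longrightarrow> v \<in> V \<Longrightarrow> {u, v} \<in> E \<longleftrightarrow> fst (f u) \<noteq> fst (f v)"
    using multipartite_coordinates[OF assms(4,5,6) _ _ assms(8,1)] assms(2,3,7) by auto
  \<comment> \<open>Colors are assigned to sets, so the color is read off some ordering of the ends;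
    \<open>grid_color\<close> is symmetric, so the ordering does not matter.\<close>
  define c :: "'a set \<Rightarrow> nat" where
    "c e = (if \<exists>u\<in>e. \<exists>v\<in>e. u \<noteq> v \<and> grid_color m (f u) (f v) then 1 else 0)" for e
  have c: "c {u, v} = (if grid_color m (f u) (f v) then 1 else 0)" if "u \<noteq> v" for u v
    using that grid_color_commute[of m "f u" "f v"] by (auto simp: c_def)
  have "rainbow_k_connected k V E c"
    by (rule grid_coloring_rainbow_k_connected[OF f c m(1) ml k])
  moreover have "c ` E \<subseteq> {..<2}" by (auto simp: c_def)
  ultimately have "rc k V E \<le> enat 2" unfolding rc_def by (intro INF_lower) blast
  then show "rc k V E \<le> 2" by (simp add: numeral_eq_enat)
  \<comment> \<open>The lower bound needs two distinct vertices. Part 0 is full as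
    \<open>l \<ge> 1\<close>, and it has indices 0 and 1 because
    \<open>1 \<le> p < r\<close>.\<close>
  have "(0, 0) \<in> f ` V" "(0, 1) \<in> f ` V" using f(3) l assms(2,3) by auto
  then obtain u v where uv: "u \<in> V" "v \<in> V" "f u = (0, 0)" "f v = (0, 1)" by fastforce
  then have "u \<noteq> v" by auto
  then show "2 \<le> rc k V E" by (rule two_le_rc[OF assms(9) uv(1,2)])
qed

end
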